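(* Let $X$ be an infinite-dimensional Fréchet space, $Y$ a separable Fréchet space and $(T_n)_{n\ge 1}$ a sequence of continuous linear operators from $X$ to $Y$. Let $(p_n)_{n\ge 1}$ be an increasing sequence of seminorms defining the topology of $X$. If there exists a continuous seminorm $p$ on $X$ such that $p(x)>0$ for every vector $x\in X$ that is hypercyclic for $(T_n)$, and if there exist a sequence $(E_n)_{n\ge 1}$ of subspaces of $X$ of finite codimension, a sequence $(C_n)_{n\ge 1}$ of numbers with $C_n\to\infty$ and a continuous seminorm $q$ on $Y$ such that for any $n\ge 1$ and any $x\in E_n$, $$q(T_nx)\ge C_n\,p_n(x),$$ then $(T_n)$ does not possess any hypercyclic subspace.
   Context: A vector $x\in X$ is hypercyclic for $(T_n)$ if $\{T_nx: n\ge 1\}$ is dense in $Y$. A hypercyclic subspace for $(T_n)$ is an infinite-dimensional closed linear subspace of $X$ in which every non-zero vector is hypercyclic for $(T_n)$. It is not assumed that $X$ possesses a continuous norm. Scalars are real or complex. *)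

theory Defs
  imports "HOL-Analysis.Analysis"
begin

text \<open>
  The scalar field is a type of sort \<open>{real_normed_field, euclidean_space}\<close>, of which
  \<^typ>\<open>real\<close> and \<^typ>\<open>complex\<close> are instances.  Up to isometric isomorphism these are the only ones:
  such a type is a finite field extension of the reals with a multiplicative norm.  A statement that
  is polymorphic in this sort is therefore a statement about real or complex scalars.

  A vector space is the whole of a type, with the scalar multiplication as a parameter
  (locale \<^locale>\<open>vector_space\<close>), and its topology is that of the type.
\<close>

definition scalar_convex ::
    "('k::real_normed_field \<Rightarrow> 'a::ab_group_add \<Rightarrow> 'a) \<Rightarrow> 'a set \<Rightarrow> bool" where
  "scalar_convex smul S \<longleftrightarrow>
     (\<forall>x\<in>S. \<forall>y\<in>S. \<forall>u\<ge>0. \<forall>v\<ge>0. u + v = 1 \<longrightarrow>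
        smul (of_real u) x + smul (of_real v) y \<in> S)"

locale frechet_space = vector_space smul
  for smul :: "'k::{real_normed_field, euclidean_space} \<Rightarrow>
                'a::{ab_group_add, topological_space} \<Rightarrow> 'a" +
  assumes continuous_add: "continuous_on UNIV (\<lambda>(x::'a, y). x + y)"
    and continuous_scale: "continuous_on UNIV (\<lambda>(c, x). smul c x)"
    and locally_convex:
      "\<And>U. open U \<Longrightarrow> 0 \<in> U \<Longrightarrow> \<exists>V. open V \<and> 0 \<in> V \<and> V \<subseteq> U \<and> scalar_convex smul V"
    and complete_invariant_metric:
      "\<exists>d. Metric_space (UNIV::'a set) d \<and>
           (\<forall>x y z. d (x + z) (y + z) = d x y) \<and>
           Metric_space.mtopology UNIV d = euclidean \<and>
           Metric_space.mcomplete UNIV d"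

definition seminorm ::
    "('k::real_normed_field \<Rightarrow> 'a::ab_group_add \<Rightarrow> 'a) \<Rightarrow> ('a \<Rightarrow> real) \<Rightarrow> bool" where
  "seminorm smul p \<longleftrightarrow>
     (\<forall>x. p x \<ge> 0) \<and> (\<forall>x y. p (x + y) \<le> p x + p y) \<and> (\<forall>c x. p (smul c x) = norm c * p x)"

definition continuous_seminorm ::
    "('k::real_normed_field \<Rightarrow> 'a::{ab_group_add, topological_space} \<Rightarrow> 'a) \<Rightarrow>
     ('a \<Rightarrow> real) \<Rightarrow> bool" where
  "continuous_seminorm smul p \<longleftrightarrow> seminorm smul p \<and> continuous_on UNIV p"

text \<open>The topology of the type is the one for which the open semiballs of the \<open>p i\<close>, \<open>i \<in> I\<close>,
  around all points form a subbase.\<close>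

definition seminorms_define_topology ::
    "'i set \<Rightarrow> ('i \<Rightarrow> 'a::{ab_group_add, topological_space} \<Rightarrow> real) \<Rightarrow> bool" where
  "seminorms_define_topology I p \<longleftrightarrow>
     (\<forall>U::'a set. open U \<longleftrightarrow>
        generate_topology {{y. p i (y - x) < e} | i x e. i \<in> I \<and> e > 0} U)"

definition finite_dim ::
    "('k::field \<Rightarrow> 'a::ab_group_add \<Rightarrow> 'a) \<Rightarrow> 'a set \<Rightarrow> bool" where
  "finite_dim smul S \<longleftrightarrow> (\<exists>B. finite B \<and> B \<subseteq> S \<and> S \<subseteq> module.span smul B)"

definition finite_codim ::
    "('k::field \<Rightarrow> 'a::ab_group_add \<Rightarrow> 'a) \<Rightarrow> 'a set \<Rightarrow> bool" where
  "finite_codim smul E \<longleftrightarrow>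
     (\<exists>F. module.subspace smul F \<and> finite_dim smul F \<and>
          E \<inter> F = {0} \<and> (\<forall>x. \<exists>u\<in>E. \<exists>v\<in>F. x = u + v))"

definition continuous_linear ::
    "('k::field \<Rightarrow> 'a::{ab_group_add, topological_space} \<Rightarrow> 'a) \<Rightarrow>
     ('k \<Rightarrow> 'b::{ab_group_add, topological_space} \<Rightarrow> 'b) \<Rightarrow> ('a \<Rightarrow> 'b) \<Rightarrow> bool" where
  "continuous_linear scaleX scaleY f \<longleftrightarrow>
     Vector_Spaces.linear scaleX scaleY f \<and> continuous_on UNIV f"

text \<open>Operator sequences are indexed by \<open>n \<ge> 1\<close>; \<open>T 0\<close> plays no role.\<close>

definition hypercyclic ::
    "(nat \<Rightarrow> 'a \<Rightarrow> 'b::topological_space) \<Rightarrow> 'a \<Rightarrow> bool" where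
  "hypercyclic T x \<longleftrightarrow> closure {T n x | n. n \<ge> 1} = UNIV"

definition hypercyclic_subspace ::
    "('k::field \<Rightarrow> 'a::{ab_group_add, topological_space} \<Rightarrow> 'a) \<Rightarrow>
     (nat \<Rightarrow> 'a \<Rightarrow> 'b::topological_space) \<Rightarrow> 'a set \<Rightarrow> bool" where
  "hypercyclic_subspace smul T M \<longleftrightarrow>
     module.subspace smul M \<and> closed M \<and> \<not> finite_dim smul M \<and>
     (\<forall>x\<in>M. x \<noteq> 0 \<longrightarrow> hypercyclic T x)"

end

theory Submission
  imports Defs
begin

text \<open>
  On a hypercyclic subspace \<open>M\<close> some seminorm \<open>p n\<^sub>0\<close>, and hence every later one, is a norm.  By
  the Hahn--Banach theorem, for a seminorm \<open>r\<close> and a vector \<open>u\<close> the inequality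
  \<open>r u \<le> r (u + v)\<close> holds for all \<open>v\<close> in a subspace of finite codimension.  Since \<open>M\<close> meets finitely
  many such subspaces and finitely many \<open>E n\<close> in a nonzero vector, one can choose successively
  \<open>y k \<in> M\<close> with \<open>p (n\<^sub>0 + k) (y k) = 2\<^bsup>-k\<^esup>\<close> such that \<open>y k \<in> E n\<close> for all \<open>n < N (k + 1)\<close> and adding
  \<open>y k\<close> to the partial sum does not decrease its value under \<open>q \<circ> T n\<close>.  The series converges to
  some \<open>x \<in> M\<close>, and for \<open>N k \<le> n < N (k + 1)\<close> the triangle inequality yields
  \<open>q (T n x) \<ge> q (T n (y k)) / 2 \<ge> C n 2\<^bsup>-k\<^esup> / 2\<close>, which is at least \<open>1\<close> if \<open>N k\<close> is large.
  Hence \<open>x\<close> is nonzero but not hypercyclic.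
\<close>

section \<open>The real Hahn-Banach theorem for sublinear functionals\<close>

text \<open>Homogeneity is required only as an inequality, which is easier to verify for infima;
  using it for \<open>t\<close> and for \<open>1/t\<close> gives equality.\<close>

definition sublinear :: "(real \<Rightarrow> 'a::ab_group_add \<Rightarrow> 'a) \<Rightarrow> ('a \<Rightarrow> real) \<Rightarrow> bool" where
  "sublinear sc s \<longleftrightarrow> (\<forall>x y. s (x + y) \<le> s x + s y) \<and> (\<forall>t>0. \<forall>x. s (sc t x) \<le> t * s x)"

lemma sublinear_add: "sublinear sc s \<Longrightarrow> s (x + y) \<le> s x + s y"
  and sublinear_scale_le: "sublinear sc s \<Longrightarrow> t > 0 \<Longrightarrow> s (sc t x) \<le> t * s x"
  by (auto simp: sublinear_def)

context
  fixes sc :: "real \<Rightarrow> 'a::ab_group_add \<Rightarrow> 'a"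
  assumes vs: "vector_space sc"
begin

interpretation vector_space sc by (rule vs)

lemma sublinear_scale:
  assumes s: "sublinear sc s" and t: "t > 0"
  shows "s (sc t x) = t * s x"
proof (rule antisym)
  show "s (sc t x) \<le> t * s x" using sublinear_scale_le[OF s t] .
  have "s (sc (1/t) (sc t x)) \<le> (1/t) * s (sc t x)"
    using t by (intro sublinear_scale_le[OF s]) auto
  then show "t * s x \<le> s (sc t x)" using t by (simp add: field_simps)
qed

lemma sublinear_zero:
  assumes s: "sublinear sc s"
  shows "s 0 = 0"
  using sublinear_scale[OF s, of 2 0] by simp

lemma sublinear_minus_le:
  assumes s: "sublinear sc s"
  shows "- s (- x) \<le> s x"
  using sublinear_add[OF s, of x "- x"] sublinear_zero[OF s] by simp

text \<open>\<open>s'\<close> is the infimum over \<open>t \<ge> 0\<close> of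
  \<open>s (x + sc t y) - t * s y\<close>; \<open>t = 0\<close> gives \<open>s' \<le> s\<close> and
  \<open>t = 1\<close> the last bound.\<close>

lemma sublinear_shift:
  assumes s: "sublinear sc s"
  obtains s' where "sublinear sc s'" "s' \<le> s" "\<And>x. s' x \<le> s (x + y) - s y"
proof -
  define h where "h x t = s (x + sc t y) - t * s y" for x t
  define s' where "s' x = (INF t\<in>{0..}. h x t)" for x
  have sc0: "s (sc t z) = t * s z" if "t \<ge> 0" for t z
    using that sublinear_scale[OF s, of t z] sublinear_zero[OF s] by (cases "t = 0") auto
  \<comment> \<open>This bound, independent of \<open>t\<close>, makes the infimum finite.\<close>
  have lb: "- s (- x) \<le> h x t" if "t \<ge> 0" for x t
    using sublinear_add[OF s, of "x + sc t y" "- x"] sc0[OF that] by (simp add: h_def)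
  have le: "s' x \<le> h x t" if "t \<ge> 0" for x t
    unfolding s'_def using that lb by (intro cINF_lower bdd_belowI2[where m="- s (- x)"]) auto
  have ge: "c \<le> s' x" if "\<And>t. t \<ge> 0 \<Longrightarrow> c \<le> h x t" for x c
    unfolding s'_def using that by (intro cINF_greatest) auto
  show ?thesis
  proof
    show "sublinear sc s'"
      unfolding sublinear_def
    proof (intro conjI allI impI)
      fix x z
      \<comment> \<open>Subadditivity takes two infima in turn: over \<open>t'\<close> with
        \<open>t\<close> fixed, then over \<open>t\<close>.\<close>
      have "s' (x + z) - h x t \<le> s' z" if "t \<ge> 0" for t
      proof (rule ge)
        fix t' :: real assume "t' \<ge> 0"
        have "s' (x + z) \<le> h (x + z) (t + t')" using le that \<open>t' \<ge> 0\<close> by simp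
        also have "\<dots> \<le> h x t + h z t'"
          using sublinear_add[OF s, of "x + sc t y" "z + sc t' y"]
          by (simp add: h_def scale_left_distrib algebra_simps)
        finally show "s' (x + z) - h x t \<le> h z t'" by simp
      qed
      then have "s' (x + z) - s' z \<le> s' x" by (intro ge) (simp add: algebra_simps)
      then show "s' (x + z) \<le> s' x + s' z" by simp
    next
      fix t :: real and x assume t: "t > 0"
      have "s' (sc t x) / t \<le> s' x"
      proof (rule ge)
        fix t' :: real assume t': "t' \<ge> 0"
        have "s' (sc t x) \<le> h (sc t x) (t * t')" using le t t' by simp
        also have "\<dots> = t * h x t'"
          using sublinear_scale[OF s t, of "x + sc t' y"]
          by (simp add: h_def scale_right_distrib algebra_simps)
        finally show "s' (sc t x) / t \<le> h x t'" using t by (simp add: field_simps)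
      qed
      then show "s' (sc t x) \<le> t * s' x" using t by (simp add: field_simps)
    qed
    show "s' \<le> s" using le[of 0] by (auto simp: le_fun_def h_def)
    show "s' x \<le> s (x + y) - s y" for x using le[of 1 x] by (simp add: h_def)
  qed
qed

text \<open>Lower bounds of chains for Zorn's lemma. The pointwise infimum is finite because
  \<open>- r (- x)\<close> bounds the chain from below, and it is subadditive because two members of
  the chain have a common minorant in it.\<close>

lemma sublinear_chain_Inf:
  assumes C: "C \<noteq> {}" "\<And>s. s \<in> C \<Longrightarrow> sublinear sc s \<and> s \<le> r"
    and chain: "\<And>s s'. s \<in> C \<Longrightarrow> s' \<in> C \<Longrightarrow> s \<le> s' \<or> s' \<le> s"
  obtains g where "sublinear sc g" "g \<le> r" "\<And>s. s \<in> C \<Longrightarrow> g \<le> s"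
proof -
  define g where "g x = (INF s\<in>C. s x)" for x
  have lb: "- r (- x) \<le> s x" if "s \<in> C" for s x
    using C(2)[OF that] sublinear_minus_le[of s x] by (auto simp: le_fun_def dest: spec[of _ "- x"])
  have le: "g x \<le> s x" if "s \<in> C" for s x
    unfolding g_def using that lb by (intro cINF_lower bdd_belowI2[where m="- r (- x)"]) auto
  have ge: "c \<le> g x" if "\<And>s. s \<in> C \<Longrightarrow> c \<le> s x" for x c
    unfolding g_def using that C(1) by (intro cINF_greatest) auto
  show ?thesis
  proof
    show "sublinear sc g"
      unfolding sublinear_def
    proof (intro conjI allI impI)
      fix x y
      have "g (x + y) - s x \<le> g y" if s: "s \<in> C" for s
      proof (rule ge)
        fix s' assume s': "s' \<in> C"
        obtain m where m: "m \<in> C" "m \<le> s" "m \<le> s'" using chain[OF s s'] s s' by blast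
        have "g (x + y) \<le> m (x + y)" by (rule le[OF m(1)])
        also have "\<dots> \<le> m x + m y" using C(2)[OF m(1)] sublinear_add by blast
        also have "\<dots> \<le> s x + s' y" using m(2,3) by (intro add_mono) (auto simp: le_fun_def)
        finally show "g (x + y) - s x \<le> s' y" by simp
      qed
      then have "g (x + y) - g y \<le> g x" by (intro ge) (simp add: algebra_simps)
      then show "g (x + y) \<le> g x + g y" by simp
    next
      fix t :: real and x assume t: "t > 0"
      have "g (sc t x) / t \<le> g x"
      proof (rule ge)
        fix s assume s: "s \<in> C"
        have "g (sc t x) \<le> s (sc t x)" by (rule le[OF s])
        also have "\<dots> \<le> t * s x" using C(2)[OF s] t sublinear_scale_le by blast
        finally show "g (sc t x) / t \<le> s x" using t by (simp add: field_simps)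
      qed
      then show "g (sc t x) \<le> t * g x" using t by (simp add: field_simps)
    qed
    show "g \<le> s" if "s \<in> C" for s using le[OF that] by (auto simp: le_fun_def)
    then show "g \<le> r" using C by (meson all_not_in_conv order_trans)
  qed
qed

text \<open>A minimal sublinear functional \<open>f\<close> coincides with its shifts, so that
  \<open>f x \<le> f (x + y) - f y\<close>, and hence is linear.\<close>

lemma hahn_banach_real:
  assumes r: "sublinear sc r"
  obtains f where "Vector_Spaces.linear sc (*) f" "\<And>x. f x \<le> r x" "f u = r u"
proof -
  \<comment> \<open>Shifting by \<open>u\<close> first gives \<open>r0 (- u) \<le> - r u\<close>, so
    a linear \<open>f \<le> r0\<close> must satisfy \<open>f u \<ge> r u\<close>.\<close>
  obtain r0 where r0: "sublinear sc r0" "r0 \<le> r" "\<And>x. r0 x \<le> r (x + u) - r u"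
    using sublinear_shift[OF r, of u] by blast
  define A where "A = {s. sublinear sc s \<and> s \<le> r0}"
  \<comment> \<open>Zorn's lemma provides maximal elements, so the order is reversed to obtain a
    minimal functional.\<close>
  define P where "P = (\<lambda>s s' :: 'a \<Rightarrow> real. s' \<le> s)"
  have "\<exists>m\<in>A. \<forall>a\<in>A. P m a \<longrightarrow> a = m"
  proof (rule predicate_Zorn)
    show "partial_order_on A (relation_of P A)"
      by (rule partial_order_on_relation_ofI) (auto simp: P_def)
    fix C assume C: "C \<in> Chains (relation_of P A)"
    show "\<exists>g\<in>A. \<forall>a\<in>C. P a g"
    proof (cases "C = {}")
      case True
      then show ?thesis using r0 by (auto simp: A_def)
    next
      case False
      have "\<And>s. s \<in> C \<Longrightarrow> sublinear sc s \<and> s \<le> r0"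
        using Chains_relation_of[OF C] by (auto simp: A_def)
      moreover have "\<And>s s'. s \<in> C \<Longrightarrow> s' \<in> C \<Longrightarrow> s \<le> s' \<or> s' \<le> s"
        using C by (fastforce simp: Chains_def relation_of_def P_def)
      ultimately obtain g where "sublinear sc g" "g \<le> r0" "\<And>s. s \<in> C \<Longrightarrow> g \<le> s"
        using sublinear_chain_Inf[OF False] by metis
      then show ?thesis by (auto simp: A_def P_def)
    qed
  qed
  then obtain f where f: "sublinear sc f" "f \<le> r0"
    and fmin: "\<And>s. sublinear sc s \<Longrightarrow> s \<le> f \<Longrightarrow> s = f"
    unfolding A_def P_def by (auto intro: order_trans)
  have add: "f (x + y) = f x + f y" for x y
  proof (rule antisym)
    show "f (x + y) \<le> f x + f y" by (rule sublinear_add[OF f(1)])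
    obtain s' where s': "sublinear sc s'" "s' \<le> f" "\<And>x. s' x \<le> f (x + y) - f y"
      using sublinear_shift[OF f(1), of y] by blast
    show "f x + f y \<le> f (x + y)" using s'(3)[of x] fmin[OF s'(1,2)] by simp
  qed
  have neg: "f (- x) = - f x" for x using add[of x "- x"] sublinear_zero[OF f(1)] by simp
  have scale: "f (sc t x) = t * f x" for t x
  proof -
    consider "t > 0" | "t = 0" | "- t > 0" by linarith
    then show ?thesis
    proof cases
      case 3
      show ?thesis using sublinear_scale[OF f(1) 3, of x] neg[of "sc t x"] by simp
    qed (simp_all add: sublinear_scale[OF f(1)] sublinear_zero[OF f(1)])
  qed
  have le: "f x \<le> r x" for x using f(2) r0(2) by (auto simp: le_fun_def intro: order_trans)
  show ?thesis
  proof
    have "vector_space ((*) :: real \<Rightarrow> real \<Rightarrow> real)"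
      by unfold_locales (auto simp: algebra_simps)
    then show "Vector_Spaces.linear sc (*) f"
      using add scale vs by (simp add: Vector_Spaces.linear_iff)
    show "f x \<le> r x" for x by (rule le)
    have "f (- u) \<le> r (- u + u) - r u" using f(2) r0(3)[of "- u"]
      by (auto simp: le_fun_def intro: order_trans)
    then have "r u \<le> f u" using neg sublinear_zero[OF r] by simp
    then show "f u = r u" using le[of u] by simp
  qed
qed

end

section \<open>Infinite-dimensional subspaces and finite codimension\<close>

text \<open>Finite codimension without reference to a complement, in the form that the Hahn-Banach
  argument below delivers.\<close>

definition cofinite_subspace :: "('k::field \<Rightarrow> 'a::ab_group_add \<Rightarrow> 'a) \<Rightarrow> 'a set \<Rightarrow> bool" where
  "cofinite_subspace smul E \<longleftrightarrow>
     module.subspace smul E \<and> (\<exists>B. finite B \<and> module.span smul (E \<union> B) = UNIV)"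

context vector_space
begin

text \<open>Adjoining \<open>b\<close> to \<open>E\<close> raises the dimension of the intersection
  by at most one: if \<open>w\<close> is a new vector in it, subtracting a multiple of
  \<open>w\<close> cancels the \<open>b\<close>-component of any other.\<close>

lemma finite_dim_Int_step:
  assumes M: "subspace M" and E: "subspace E" and fin: "finite_dim scale (M \<inter> E)"
  shows "finite_dim scale (M \<inter> span (insert b E))"
proof (cases "M \<inter> span (insert b E) \<subseteq> E")
  case True
  then have "M \<inter> span (insert b E) = M \<inter> E" by (auto intro: span_base)
  then show ?thesis using fin by simp
next
  case False
  obtain B where B: "finite B" "B \<subseteq> M \<inter> E" "M \<inter> E \<subseteq> span B"
    using fin by (auto simp: finite_dim_def)
  from False obtain w where w: "w \<in> M" "w \<in> span (insert b E)" "w \<notin> E" by auto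
  obtain c where c: "w - scale c b \<in> E"
    using w(2) by (auto simp: span_breakdown_eq span_eq_iff[THEN iffD2, OF E])
  have c0: "c \<noteq> 0" using c w(3) by auto
  have "M \<inter> span (insert b E) \<subseteq> span (insert w B)"
  proof
    fix x assume x: "x \<in> M \<inter> span (insert b E)"
    then obtain d where d: "x - scale d b \<in> E"
      by (auto simp: span_breakdown_eq span_eq_iff[THEN iffD2, OF E])
    have eq: "x - scale (d / c) w = (x - scale d b) - scale (d / c) (w - scale c b)"
      using c0 by (simp add: scale_right_diff_distrib)
    have "x - scale (d / c) w \<in> E"
      unfolding eq by (rule subspace_diff[OF E d subspace_scale[OF E c]])
    moreover have "x - scale (d / c) w \<in> M"
      using x w(1) M by (auto intro: subspace_diff subspace_scale)
    ultimately have "x - scale (d / c) w \<in> span B" using B(3) by auto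
    then show "x \<in> span (insert w B)" by (auto simp: span_breakdown_eq)
  qed
  moreover have "insert w B \<subseteq> M \<inter> span (insert b E)"
    using w B(2) by (auto intro: span_base)
  ultimately show ?thesis using B(1) unfolding finite_dim_def by (intro exI[of _ "insert w B"]) auto
qed

text \<open>The vectors of \<open>B\<close> are moved into \<open>E\<close> one at a time, until
  \<open>E\<close> contains \<open>M\<close>.\<close>

lemma finite_dim_if_finite_dim_Int:
  assumes "finite B" and M: "subspace M" and "subspace E" and "M \<subseteq> span (E \<union> B)"
    and "finite_dim scale (M \<inter> E)"
  shows "finite_dim scale M"
  using assms(1,3-)
proof (induction B arbitrary: E)
  case empty
  then have "M \<inter> E = M" using span_eq_iff[THEN iffD2, OF empty(1)] by auto
  then show ?case using empty by simp
next
  case (insert b B)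
  show ?case
  proof (rule insert.IH)
    show "subspace (span (insert b E))" by simp
    have "span (E \<union> insert b B) \<subseteq> span (span (insert b E) \<union> B)"
      by (intro span_mono) (auto intro: span_base)
    then show "M \<subseteq> span (span (insert b E) \<union> B)" using insert.prems by blast
    show "finite_dim scale (M \<inter> span (insert b E))"
      using finite_dim_Int_step M insert.prems by blast
  qed
qed

lemma finite_codim_imp_cofinite:
  assumes "subspace E" "finite_codim scale E"
  shows "cofinite_subspace scale E"
proof -
  obtain F B where B: "finite B" "F \<subseteq> span B" "\<And>x. \<exists>u\<in>E. \<exists>v\<in>F. x = u + v"
    using assms(2) unfolding finite_codim_def finite_dim_def by blast
  have "x \<in> span (E \<union> B)" for x
  proof -
    obtain u v where "u \<in> E" "v \<in> F" "x = u + v" using B(3) by blast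
    then show ?thesis
      using B(2) span_mono[of B "E \<union> B"] by (auto intro!: span_add intro: span_base)
  qed
  then show ?thesis using assms(1) B(1) by (auto simp: cofinite_subspace_def)
qed

lemma infinite_dim_Int_cofinite:
  assumes "subspace M" "\<not> finite_dim scale M" "cofinite_subspace scale E"
  shows "\<not> finite_dim scale (M \<inter> E)"
  using assms finite_dim_if_finite_dim_Int[of _ M E] unfolding cofinite_subspace_def by auto

lemma infinite_dim_Int_cofinite_INT:
  assumes "finite I" "subspace M" "\<not> finite_dim scale M" "\<And>i. i \<in> I \<Longrightarrow> cofinite_subspace scale (E i)"
  shows "subspace (M \<inter> (\<Inter>i\<in>I. E i)) \<and> \<not> finite_dim scale (M \<inter> (\<Inter>i\<in>I. E i))"
  using assms(1,4)
proof (induction I)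
  case empty
  then show ?case using assms(2,3) by simp
next
  case (insert i I)
  let ?M = "M \<inter> (\<Inter>i\<in>I. E i)"
  have "M \<inter> (\<Inter>i\<in>insert i I. E i) = ?M \<inter> E i" by auto
  moreover have "subspace ?M" "\<not> finite_dim scale ?M" "cofinite_subspace scale (E i)"
    using insert by auto
  ultimately show ?case
    using infinite_dim_Int_cofinite by (auto simp: cofinite_subspace_def intro: subspace_inter)
qed

lemma infinite_dim_nonzero:
  assumes "\<not> finite_dim scale M"
  obtains x where "x \<in> M" "x \<noteq> 0"
proof -
  have "\<not> M \<subseteq> {0}"
    using assms unfolding finite_dim_def by (metis finite.emptyI empty_subsetI span_empty)
  then show ?thesis using that by auto
qed

end

section \<open>Seminorms that do not decrease along a subspace of finite codimension\<close>

text \<open>The Hahn--Banach functional \<open>f\<close> is only real-linear; the largest subspace \<open>W\<close> of its kernel that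
  is invariant under all scalars still has finite codimension, as the scalar field has finite
  dimension over the reals.\<close>

lemma seminorm_orthogonal_cofinite:
  fixes smul :: "'k::{real_normed_field, euclidean_space} \<Rightarrow> 'a::ab_group_add \<Rightarrow> 'a"
  assumes vs: "vector_space smul" and r: "seminorm smul r"
  obtains W where "cofinite_subspace smul W" "\<And>v. v \<in> W \<Longrightarrow> r u \<le> r (u + v)"
proof -
  interpret vector_space smul by (rule vs)
  define sc where "sc t = smul (of_real t)" for t :: real
  have vsr: "vector_space sc"
    by unfold_locales (auto simp: sc_def scale_left_distrib scale_right_distrib)
  have "sublinear sc r"
    using r by (auto simp: sublinear_def seminorm_def sc_def)
  then obtain f where f: "Vector_Spaces.linear sc (*) f" "\<And>x. f x \<le> r x" "f u = r u"
    using hahn_banach_real[OF vsr] by blast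
  interpret f: Vector_Spaces.linear sc "(*)" f by (rule f(1))
  define W where "W = {x. \<forall>c. f (smul c x) = 0}"
  \<comment> \<open>\<open>G\<close> collects the real functionals \<open>f (smul b x)\<close>, with
    \<open>b\<close> in the real basis of the scalar field, into one real-linear map; its kernel
    lies in \<open>W\<close>.\<close>
  define G :: "'a \<Rightarrow> 'k" where "G x = (\<Sum>b\<in>Basis. f (smul b x) *\<^sub>R b)" for x
  have G_add: "G (x + y) = G x + G y" for x y
    by (simp add: G_def scale_right_distrib f.add scaleR_left_distrib sum.distrib)
  have G_scale: "G (sc t x) = t *\<^sub>R G x" for t x
  proof -
    have "smul b (sc t x) = sc t (smul b x)" for b by (simp add: sc_def mult.commute)
    then show ?thesis by (simp add: G_def f.scale scaleR_sum_right)
  qed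
  have G_zero: "G 0 = 0" using G_add[of 0 0] by simp
  have G_diff: "G (x - y) = G x - G y" for x y
    using G_add[of "x - y" y] by (simp add: algebra_simps)
  have G0: "x \<in> W" if "G x = 0" for x
  proof -
    have b0: "f (smul b x) = 0" if "b \<in> Basis" for b
      using arg_cong[OF \<open>G x = 0\<close>, of "\<lambda>y. y \<bullet> b"] that by (simp add: G_def)
    have "f (smul c x) = 0" for c
    proof -
      have "smul c x = smul (\<Sum>b\<in>Basis. (c \<bullet> b) *\<^sub>R b) x" by (simp add: euclidean_representation)
      also have "\<dots> = (\<Sum>b\<in>Basis. sc (c \<bullet> b) (smul b x))"
        by (simp add: scale_sum_left scaleR_conv_of_real sc_def)
      finally show ?thesis by (simp add: f.sum f.scale b0)
    qed
    then show ?thesis by (simp add: W_def)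
  qed
  have W: "subspace W"
    by (rule subspaceI) (auto simp: W_def scale_right_distrib f.add f.zero)
  have "real_vector.subspace (range G)"
    by (rule real_vector.subspaceI)
       (auto simp: G_add[symmetric] G_scale[symmetric] intro: range_eqI[of _ _ 0] simp: G_zero)
  then obtain B0 where B0: "finite B0" "B0 \<subseteq> range G" "real_vector.span B0 = range G"
    using basis_subspace_exists by metis
  \<comment> \<open>Preimages of finitely many vectors spanning the range of \<open>G\<close>: each
    \<open>x\<close> then differs from an element of \<open>span B\<close> by a vector in the kernel
    of \<open>G\<close>.\<close>
  define B where "B = inv G ` B0"
  have "real_vector.subspace (G ` span B)"
  proof (rule real_vector.subspaceI)
    show "0 \<in> G ` span B" using G_zero span_zero by (metis image_eqI)
  qed (auto simp: G_add[symmetric] G_scale[symmetric] sc_def intro!: imageI span_add span_scale)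
  moreover have "B0 \<subseteq> G ` span B"
  proof
    fix g assume "g \<in> B0"
    then have "g = G (inv G g)" "inv G g \<in> span B"
      using B0(2) by (auto simp: f_inv_into_f B_def intro: span_base)
    then show "g \<in> G ` span B" by blast
  qed
  ultimately have cover: "range G \<subseteq> G ` span B"
    using B0(3) real_vector.span_minimal by metis
  have "x \<in> span (W \<union> B)" for x
  proof -
    obtain z where z: "z \<in> span B" "G x = G z" using cover by blast
    have "x - z \<in> span (W \<union> B)" by (intro span_base UnI1 G0) (simp add: G_diff z)
    moreover have "z \<in> span (W \<union> B)" using z(1) span_mono[of B "W \<union> B"] by auto
    ultimately show ?thesis using span_add[of "x - z" "W \<union> B" z] by simp
  qed
  then have "cofinite_subspace smul W"
    using W B0(1) by (auto simp: cofinite_subspace_def B_def)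
  \<comment> \<open>Since \<open>f\<close> vanishes at \<open>v\<close>,
    \<open>r u = f u = f (u + v) \<le> r (u + v)\<close>.\<close>
  moreover have "r u \<le> r (u + v)" if "v \<in> W" for v
  proof -
    have "f (smul 1 v) = 0" using that unfolding W_def by blast
    then show ?thesis using f(2)[of "u + v"] f(3) by (simp add: f.add)
  qed
  ultimately show ?thesis using that by blast
qed

section \<open>Completeness, neighbourhoods and non-dense orbits\<close>

text \<open>By translation invariance, \<open>S m - S n\<close> lies in the ball of radius
  \<open>e\<close> around \<open>0\<close> exactly when \<open>d (S m) (S n) < e\<close>, so the
  sequence is Cauchy for the complete metric.\<close>

lemma (in frechet_space) convergent_if_Cauchy:
  fixes S :: "nat \<Rightarrow> 'a"
  assumes "\<And>U. open U \<Longrightarrow> 0 \<in> U \<Longrightarrow> \<exists>N. \<forall>m\<ge>N. \<forall>n\<ge>N. S m - S n \<in> U"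
  obtains x where "S \<longlonglongrightarrow> x"
proof -
  obtain d where d: "Metric_space (UNIV::'a set) d" "\<And>x y z. d (x + z) (y + z) = d x y"
    "Metric_space.mtopology UNIV d = euclidean" "Metric_space.mcomplete UNIV d"
    using complete_invariant_metric by blast
  interpret d: Metric_space "UNIV::'a set" d by (rule d(1))
  have "d.MCauchy S"
    unfolding d.MCauchy_def
  proof (intro conjI allI impI)
    fix e :: real assume "e > 0"
    have "open (d.mball 0 e)" using d.openin_mball[of 0 e] d(3) by simp
    moreover have "0 \<in> d.mball 0 e" using \<open>e > 0\<close> by simp
    ultimately obtain N where N: "\<And>m n. m \<ge> N \<Longrightarrow> n \<ge> N \<Longrightarrow> S m - S n \<in> d.mball 0 e"
      using assms by metis
    have "d (S m) (S n) < e" if "m \<ge> N" "n \<ge> N" for m n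
      using N[OF that] d(2)[of "S m - S n" "S n" 0] by (simp add: d.commute)
    then show "\<exists>N. \<forall>n n'. N \<le> n \<longrightarrow> N \<le> n' \<longrightarrow> d (S n) (S n') < e" by blast
  qed simp
  then obtain x where "limitin d.mtopology S x sequentially"
    using d(4) by (auto simp: d.mcomplete_def)
  then show ?thesis using that by (simp add: d(3) limitin_canonical_iff)
qed

lemma increasing_seminorms_mono:
  fixes p :: "nat \<Rightarrow> 'a \<Rightarrow> real"
  assumes "\<And>n x. n \<ge> 1 \<Longrightarrow> p n x \<le> p (Suc n) x" and "1 \<le> m" "m \<le> n"
  shows "p m x \<le> p n x"
  using assms(3) by (induction n rule: dec_induct) (use assms(1,2) in \<open>auto intro: order_trans\<close>)

text \<open>Subbasic semiballs are recentred at \<open>z\<close> by the triangle inequality; for a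
  finite intersection the larger index works because the seminorms increase.\<close>

lemma seminorm_nhd_base:
  fixes p :: "nat \<Rightarrow> 'a::{ab_group_add, topological_space} \<Rightarrow> real"
  assumes p: "\<And>n. n \<ge> 1 \<Longrightarrow> seminorm smul (p n)"
    and mono: "\<And>n x. n \<ge> 1 \<Longrightarrow> p n x \<le> p (Suc n) x"
    and top: "seminorms_define_topology {1..} p"
    and U: "open U" "z \<in> U"
  obtains n e where "n \<ge> 1" "e > 0" "\<And>y. p n (y - z) < e \<Longrightarrow> y \<in> U"
proof -
  have "generate_topology {{y. p i (y - x) < e} | i x e. i \<in> {1..} \<and> e > 0} U"
    using top U(1) by (simp add: seminorms_define_topology_def)
  then have "\<exists>n\<ge>1. \<exists>e>0. \<forall>y. p n (y - z) < e \<longrightarrow> y \<in> U"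
    using U(2)
  proof (induction rule: generate_topology.induct)
    case UNIV
    show ?case by (intro exI[of _ 1] conjI) auto
  next
    case (Int A B)
    obtain m d where A: "m \<ge> 1" "d > 0" "\<And>y. p m (y - z) < d \<Longrightarrow> y \<in> A"
      using Int.IH(1) Int.prems by blast
    obtain n e where B: "n \<ge> 1" "e > 0" "\<And>y. p n (y - z) < e \<Longrightarrow> y \<in> B"
      using Int.IH(2) Int.prems by blast
    have "p m x \<le> p (max m n) x" "p n x \<le> p (max m n) x" for x
      using A(1) B(1) by (auto intro!: increasing_seminorms_mono mono)
    then have "y \<in> A \<inter> B" if "p (max m n) (y - z) < min d e" for y
      using A(3)[of y] B(3)[of y] that by (meson IntI min_less_iff_conj order_le_less_trans)
    then show ?case using A B by (intro exI[of _ "max m n"] conjI exI[of _ "min d e"]) auto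
  next
    case (UN K)
    then show ?case by blast
  next
    case (Basis A)
    then obtain i x e where i: "i \<ge> 1" "A = {y. p i (y - x) < e}" by auto
    have "p i (y - x) < e" if "p i (y - z) < e - p i (z - x)" for y
    proof -
      have "p i ((y - z) + (z - x)) \<le> p i (y - z) + p i (z - x)"
        using p[OF i(1)] unfolding seminorm_def by blast
      then show ?thesis using that by simp
    qed
    then show ?case using i Basis(2) by (intro exI[of _ i] conjI exI[of _ "e - p i (z - x)"]) auto
  qed
  then show ?thesis using that by blast
qed

text \<open>The finitely many values \<open>q (T n x)\<close>, \<open>n < N\<close>, miss a nonempty open subset of the unit
  interval, whose preimage under \<open>q\<close> then misses the whole orbit.\<close>

lemma not_hypercyclic_if_eventually_ge_one:
  assumes q: "continuous_seminorm smul q" and N: "\<And>n. n \<ge> N \<Longrightarrow> q (T n x) \<ge> 1"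
  shows "\<not> hypercyclic T x"
proof
  assume h: "hypercyclic T x"
  define O1 where "O1 = {0<..<1} - (\<lambda>n. q (T n x)) ` {..<N}"
  have "open O1" unfolding O1_def by (intro open_Diff finite_imp_closed) auto
  then have op: "open (q -` O1)"
    using q by (intro open_vimage) (auto simp: continuous_seminorm_def)
  have "infinite O1" unfolding O1_def by (intro Diff_infinite_finite) (auto simp: infinite_Ioo)
  then obtain t where t: "t \<in> O1" by (metis all_not_in_conv finite.emptyI)
  \<comment> \<open>Since \<open>q\<close> is nonzero at \<open>T N x\<close>, some multiple of this
    vector has \<open>q\<close>-value exactly \<open>t\<close>, so the preimage of \<open>O1\<close>
    is nonempty.\<close>
  have "q (T N x) \<ge> 1" by (rule N) simp
  moreover have "q (smul (of_real (t / q (T N x))) (T N x)) = \<bar>t / q (T N x)\<bar> * q (T N x)"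
    using q by (simp add: continuous_seminorm_def seminorm_def del: of_real_divide)
  ultimately have "q (smul (of_real (t / q (T N x))) (T N x)) = t"
    using t by (simp add: O1_def)
  then have ne: "q -` O1 \<noteq> {}" using t by auto
  have "q (T n x) \<notin> O1" for n using N[of n] by (cases "n < N") (auto simp: O1_def)
  then have "q -` O1 \<inter> {T n x | n. n \<ge> 1} = {}" by auto
  then have "q -` O1 \<inter> closure {T n x | n. n \<ge> 1} = {}" using open_Int_closure_eq_empty[OF op] by blast
  then show False using h ne by (simp add: hypercyclic_def)
qed

section \<open>Construction of the vector as a series in \<open>M\<close>\<close>

context frechet_space
begin

text \<open>The seminorms \<open>r n\<close> stand for \<open>q \<circ> T n\<close>, so the
  construction takes place in the domain alone.\<close>

lemma ex_vector_eventually_large: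
  fixes M :: "'a set" and E :: "nat \<Rightarrow> 'a set" and C :: "nat \<Rightarrow> real"
    and p r :: "nat \<Rightarrow> 'a \<Rightarrow> real"
  assumes p: "\<And>n. n \<ge> 1 \<Longrightarrow> seminorm smul (p n)"
    and mono: "\<And>n x. n \<ge> 1 \<Longrightarrow> p n x \<le> p (Suc n) x"
    and top: "seminorms_define_topology {1..} p"
    and M: "subspace M" "closed M" "\<not> finite_dim smul M"
    and p': "continuous_seminorm smul p'" "\<And>x. x \<in> M \<Longrightarrow> x \<noteq> 0 \<Longrightarrow> p' x > 0"
    and r: "\<And>n. n \<ge> 1 \<Longrightarrow> continuous_seminorm smul (r n)"
    and E: "\<And>n. n \<ge> 1 \<Longrightarrow> cofinite_subspace smul (E n)"
    and C: "filterlim C at_top sequentially"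
    and le: "\<And>n x. n \<ge> 1 \<Longrightarrow> x \<in> E n \<Longrightarrow> C n * p n x \<le> r n x"
  obtains x N where "x \<in> M" "\<And>n. n \<ge> N \<Longrightarrow> r n x \<ge> 1"
proof -
  have r': "seminorm smul (r n)" if "n \<ge> 1" for n
    using r[OF that] by (simp add: continuous_seminorm_def)
  have pmono: "p m x \<le> p n x" if "1 \<le> m" "m \<le> n" for m n x
    using increasing_seminorms_mono[of p, OF mono that] .
  have "open (p' -` {..<1})" "0 \<in> p' -` {..<1}"
  proof -
    show "open (p' -` {..<1})"
      using p'(1) by (intro open_vimage) (auto simp: continuous_seminorm_def)
    have "p' (smul 0 0) = 0"
      using p'(1) unfolding continuous_seminorm_def seminorm_def by (metis norm_zero mult_zero_left)
    then show "0 \<in> p' -` {..<1}" by simp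
  qed
  then obtain n0 e where n0: "n0 \<ge> 1" "e > 0" "\<And>y. p n0 (y - 0) < e \<Longrightarrow> y \<in> p' -` {..<1}"
    using seminorm_nhd_base[OF p mono top] by metis
  \<comment> \<open>If \<open>p n0 x = 0\<close>, the multiple of \<open>x\<close> by
    \<open>1 / p' x\<close> would lie in the semiball where \<open>p' < 1\<close>, although
    \<open>p'\<close> equals \<open>1\<close> there.\<close>
  have pos: "p n x > 0" if x: "x \<in> M" "x \<noteq> 0" and n: "n \<ge> n0" for n x
  proof (rule ccontr)
    assume "\<not> p n x > 0"
    then have "p n0 x \<le> 0" using pmono[OF n0(1) n, of x] by simp
    moreover have "p n0 x \<ge> 0" "p n0 (smul (of_real (1 / p' x)) x) = \<bar>1 / p' x\<bar> * p n0 x"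
      using p[OF n0(1)] by (simp_all add: seminorm_def del: of_real_divide)
    ultimately have "p n0 (smul (of_real (1 / p' x)) x - 0) < e" using n0(2) by simp
    then have "p' (smul (of_real (1 / p' x)) x) < 1" using n0(3) by blast
    moreover have "p' (smul (of_real (1 / p' x)) x) = \<bar>1 / p' x\<bar> * p' x"
      using p'(1) by (simp add: continuous_seminorm_def seminorm_def del: of_real_divide)
    ultimately show False using p'(2)[OF x] by simp
  qed
  \<comment> \<open>One factor \<open>2\<close> is lost later to the triangle inequality; the rest
    compensates \<open>p (n0 + k) y = (1/2) ^ k\<close>.\<close>
  have "\<forall>k::nat. \<exists>N. \<forall>n\<ge>N. C n \<ge> 2 ^ Suc k"
    using C by (auto simp: filterlim_at_top eventually_sequentially)
  then obtain N0 :: "nat \<Rightarrow> nat" where N0: "\<And>k n. n \<ge> N0 k \<Longrightarrow> C n \<ge> 2 ^ Suc k" by metis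
  \<comment> \<open>The term \<open>n0 + k\<close> lets \<open>p n\<close> dominate
    \<open>p (n0 + k)\<close> for \<open>n \<ge> N k\<close>, and makes \<open>N\<close>
    unbounded.\<close>
  define N where "N k = max (N0 k) (n0 + k)" for k
  \<comment> \<open>\<open>S\<close> is the partial sum before step \<open>k\<close>. The range of
    \<open>n\<close> includes all earlier blocks, so values of \<open>r n\<close> already reached
    persist.\<close>
  define Q where "Q k S y \<longleftrightarrow> y \<in> M \<and> p (n0 + k) y = (1/2) ^ k \<and>
      (\<forall>n\<in>{1..<N (Suc k)}. y \<in> E n \<and> r n S \<le> r n (S + y))" for k S y
  have "\<exists>y. Q k S y" for k S
  proof -
    have "\<exists>W. cofinite_subspace smul W \<and> (\<forall>v\<in>W. r n S \<le> r n (S + v))" if "n \<ge> 1" for n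
      using seminorm_orthogonal_cofinite[OF vector_space_axioms r'[OF that]] by metis
    then obtain W where W: "\<And>n. n \<ge> 1 \<Longrightarrow> cofinite_subspace smul (W n)"
      "\<And>n v. n \<ge> 1 \<Longrightarrow> v \<in> W n \<Longrightarrow> r n S \<le> r n (S + v)" by metis
    define I where "I = {1..<N (Suc k)}"
    have E1: "subspace (M \<inter> (\<Inter>n\<in>I. E n)) \<and> \<not> finite_dim smul (M \<inter> (\<Inter>n\<in>I. E n))"
      by (rule infinite_dim_Int_cofinite_INT) (use M E in \<open>auto simp: I_def\<close>)
    have E2: "subspace (M \<inter> (\<Inter>n\<in>I. E n) \<inter> (\<Inter>n\<in>I. W n)) \<and>
        \<not> finite_dim smul (M \<inter> (\<Inter>n\<in>I. E n) \<inter> (\<Inter>n\<in>I. W n))" (is "subspace ?V \<and> _")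
      by (rule infinite_dim_Int_cofinite_INT) (use E1 W(1) in \<open>auto simp: I_def\<close>)
    then obtain v where v: "v \<in> ?V" "v \<noteq> 0" using infinite_dim_nonzero by blast
    \<comment> \<open>Normalisation to \<open>p (n0 + k) y = (1/2) ^ k\<close>; the divisor is
      positive by \<open>pos\<close>.\<close>
    define a where "a = (1/2) ^ k / p (n0 + k) v"
    have a: "p (n0 + k) v > 0" using pos v by simp
    define y where "y = smul (of_real a) v"
    have yV: "y \<in> ?V" unfolding y_def by (rule subspace_scale[OF conjunct1[OF E2] v(1)])
    have "p (n0 + k) y = \<bar>a\<bar> * p (n0 + k) v"
      using p[of "n0 + k"] n0(1) by (simp add: seminorm_def y_def)
    then have py: "p (n0 + k) y = (1/2) ^ k" using a by (simp add: a_def abs_of_pos)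
    have "y \<in> E n \<and> r n S \<le> r n (S + y)" if "n \<in> {1..<N (Suc k)}" for n
    proof -
      have "n \<ge> 1" "y \<in> E n" "y \<in> W n" using yV that unfolding I_def by simp_all
      then show ?thesis using W(2) by simp
    qed
    then have "Q k S y" using yV py by (simp add: Q_def)
    then show ?thesis ..
  qed
  then obtain Y where "\<And>k S. Q k S (Y k S)" by metis
  then have Y: "\<And>k S. Y k S \<in> M" "\<And>k S. p (n0 + k) (Y k S) = (1/2) ^ k"
    "\<And>k S n. n \<in> {1..<N (Suc k)} \<Longrightarrow> Y k S \<in> E n \<and> r n S \<le> r n (S + Y k S)"
    unfolding Q_def by blast+
  define S where "S = rec_nat 0 (\<lambda>k S. S + Y k S)"
  have S: "S 0 = 0" "\<And>k. S (Suc k) = S k + Y k (S k)" by (simp_all add: S_def)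
  have SM: "S k \<in> M" for k
    by (induction k) (auto simp: S M(1) subspace_0 Y(1) intro: subspace_add[OF M(1)])
  \<comment> \<open>The bound is the geometric sum of \<open>(1/2) ^ j\<close> over
    \<open>i \<le> j < i + d\<close>, in a form that telescopes; \<open>m \<le> i\<close> ensures
    \<open>m \<le> n0 + j\<close>.\<close>
  have pdiff: "p m (S (i + d) - S i) \<le> 2 * (1/2) ^ i - 2 * (1/2) ^ (i + d)" if "m \<ge> 1" "m \<le> i" for m i d
  proof (induction d)
    case 0
    have "p m (smul 0 0) = norm (0::'k) * p m 0" using p[OF that(1)] unfolding seminorm_def by blast
    then show ?case by simp
  next
    case (Suc d)
    let ?y = "Y (i + d) (S (i + d))"
    have "p m (S (i + Suc d) - S i) = p m ((S (i + d) - S i) + ?y)"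
      by (simp add: S algebra_simps)
    also have "\<dots> \<le> p m (S (i + d) - S i) + p m ?y"
      using p[OF that(1)] unfolding seminorm_def by blast
    also have "p m ?y \<le> (1/2) ^ (i + d)"
      using pmono[of m "n0 + (i + d)" ?y] that Y(2)[of "i + d"] by simp
    finally show ?case using Suc by simp
  qed
  have "\<exists>K. \<forall>i\<ge>K. \<forall>j\<ge>K. S i - S j \<in> U" if U: "open U" "0 \<in> U" for U
  proof -
    obtain m d where m: "m \<ge> 1" "d > 0" "\<And>y. p m (y - 0) < d \<Longrightarrow> y \<in> U"
      using seminorm_nhd_base[OF p mono top U] by metis
    have "(\<lambda>i. 2 * (1/2::real) ^ i) \<longlonglongrightarrow> 2 * 0"
      by (intro tendsto_mult tendsto_const LIMSEQ_power_zero) simp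
    then have "\<forall>\<^sub>F i in sequentially. 2 * (1/2::real) ^ i < d"
      by (rule order_tendstoD(2)) (use m(2) in simp)
    then obtain K where K: "\<And>i. i \<ge> K \<Longrightarrow> 2 * (1/2::real) ^ i < d"
      unfolding eventually_sequentially by blast
    have le: "p m (S j - S i) < d" if "i \<ge> max K m" "i \<le> j" for i j
    proof -
      have "p m (S j - S i) \<le> 2 * (1/2) ^ i - 2 * (1/2) ^ j"
        using pdiff[of m i "j - i"] m(1) that by simp
      also have "\<dots> < d" using K[of i] that by (smt (verit) max.bounded_iff zero_le_power half_gt_zero)
      finally show ?thesis .
    qed
    have sym: "p m (S j - S i) = p m (S i - S j)" for i j
    proof -
      have "p m (smul (- 1) (S i - S j)) = norm (- 1 :: 'k) * p m (S i - S j)"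
        using p[OF m(1)] unfolding seminorm_def by blast
      then show ?thesis by (simp add: scale_minus_left)
    qed
    have "S i - S j \<in> U" if "i \<ge> max K m" "j \<ge> max K m" for i j
      using le[of i j] le[of j i] sym[of i j] that m(3)[of "S i - S j"] by (cases "i \<le> j") auto
    then show ?thesis by blast
  qed
  then obtain x where x: "S \<longlonglongrightarrow> x" using convergent_if_Cauchy by blast
  show ?thesis
  proof
    show "x \<in> M" using Lim_in_closed_set[OF M(2) _ _ x] SM by simp
    fix n assume n: "n \<ge> N 0"
    \<comment> \<open>\<open>N\<close> may fail to be monotone; with the greatest \<open>k\<close>,
      \<open>n\<close> still lies below every later \<open>N j\<close>.\<close>
    define k where "k = (GREATEST k. N k \<le> n)"
    have bd: "\<And>j. N j \<le> n \<Longrightarrow> j \<le> n" by (auto simp: N_def)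
    have k: "N k \<le> n" unfolding k_def using n bd by (rule GreatestI_nat)
    have kmax: "n < N j" if "k < j" for j
    proof (rule ccontr)
      assume "\<not> n < N j"
      then have "j \<le> k" unfolding k_def by (intro Greatest_le_nat[OF _ bd]) simp_all
      then show False using that by simp
    qed
    have n1: "n0 + k \<le> n" "n \<ge> N0 k" "n \<ge> 1" using k n0(1) by (simp_all add: N_def)
    have mem: "n \<in> {1..<N (Suc j)}" if "k \<le> j" for j using n1(3) kmax[of "Suc j"] that by simp
    let ?y = "Y k (S k)"
    have Cn: "2 ^ Suc k \<le> C n" by (rule N0[OF n1(2)])
    \<comment> \<open>The chain ends in \<open>2 \<le> 2 * r n (S (Suc k))\<close>, as
      \<open>?y\<close> is the difference of \<open>S (Suc k)\<close> and \<open>S k\<close>, and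
      \<open>r n\<close> does not decrease between them.\<close>
    have "2 = 2 ^ Suc k * (1/2::real) ^ k" by (simp add: power_one_over)
    also have "\<dots> = 2 ^ Suc k * p (n0 + k) ?y" by (simp only: Y(2))
    also have "\<dots> \<le> C n * p n ?y"
    proof (rule mult_mono[OF Cn])
      show "p (n0 + k) ?y \<le> p n ?y" using n0(1) n1(1) by (intro pmono) simp_all
      show "0 \<le> C n" using Cn by (rule order_trans[rotated]) simp
      show "0 \<le> p (n0 + k) ?y" by (simp add: Y(2))
    qed
    also have "\<dots> \<le> r n ?y" using Y(3)[OF mem[OF order_refl]] by (intro le[OF n1(3)]) simp
    also have "\<dots> \<le> r n (S (Suc k)) + r n (S k)"
    proof -
      have "r n (S (Suc k) + smul (- 1) (S k)) \<le> r n (S (Suc k)) + r n (smul (- 1) (S k))"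
        using r'[OF n1(3)] unfolding seminorm_def by blast
      moreover have "r n (smul (- 1) (S k)) = norm (- 1 :: 'k) * r n (S k)"
        using r'[OF n1(3)] unfolding seminorm_def by blast
      ultimately show ?thesis by (simp add: S scale_minus_left)
    qed
    also have "r n (S k) \<le> r n (S (Suc k))" using Y(3)[OF mem, of k "S k"] by (simp add: S)
    finally have ge1: "1 \<le> r n (S (Suc k))" by simp
    \<comment> \<open>Later summands do not decrease \<open>r n\<close>, so the bound passes to the
      limit by continuity.\<close>
    have "1 \<le> r n (S j)" if "Suc k \<le> j" for j
      using that
    proof (induction j rule: dec_induct)
      case (step j)
      then show ?case using Y(3)[OF mem, of j "S j"] by (simp add: S)
    qed (rule ge1)
    then have "\<forall>\<^sub>F j in sequentially. 1 \<le> r n (S j)" by (auto simp: eventually_sequentially)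
    moreover have "closed (r n -` {1..})"
      using r[OF n1(3)] by (intro closed_vimage) (auto simp: continuous_seminorm_def)
    ultimately have "x \<in> r n -` {1..}"
      by (intro Lim_in_closed_set[OF _ _ _ x]) auto
    then show "1 \<le> r n x" by simp
  qed
qed

end

section \<open>Application to the seminorms \<open>q \<circ> T n\<close>\<close>

theorem theorem1p13:
  fixes scaleX :: "'k::{real_normed_field, euclidean_space} \<Rightarrow>
                   'a::{ab_group_add, topological_space} \<Rightarrow> 'a"
    and scaleY :: "'k \<Rightarrow> 'b::{ab_group_add, topological_space} \<Rightarrow> 'b"
    and T :: "nat \<Rightarrow> 'a \<Rightarrow> 'b"
    and p :: "nat \<Rightarrow> 'a \<Rightarrow> real"
  assumes "frechet_space scaleX" and "\<not> finite_dim scaleX UNIV"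
    and "frechet_space scaleY" and "separable_space (euclidean :: 'b topology)"
    and "\<And>n. n \<ge> 1 \<Longrightarrow> continuous_linear scaleX scaleY (T n)"
    and "\<And>n. n \<ge> 1 \<Longrightarrow> seminorm scaleX (p n)"
    and "\<And>n x. n \<ge> 1 \<Longrightarrow> p n x \<le> p (Suc n) x"
    and "seminorms_define_topology {1..} p"
    and "\<exists>p'. continuous_seminorm scaleX p' \<and> (\<forall>x. hypercyclic T x \<longrightarrow> p' x > 0)"
    and "\<exists>(E :: nat \<Rightarrow> 'a set) (C :: nat \<Rightarrow> real) q.
           (\<forall>n\<ge>1. module.subspace scaleX (E n) \<and> finite_codim scaleX (E n)) \<and>
           filterlim C at_top sequentially \<and>
           continuous_seminorm scaleY q \<and>
           (\<forall>n\<ge>1. \<forall>x\<in>E n. q (T n x) \<ge> C n * p n x)"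
  shows "\<not> (\<exists>M. hypercyclic_subspace scaleX T M)"
proof
  interpret X: frechet_space scaleX by fact
  interpret Y: frechet_space scaleY by fact
  assume "\<exists>M. hypercyclic_subspace scaleX T M"
  then obtain M where M: "X.subspace M" "closed M" "\<not> finite_dim scaleX M"
    and hyp: "\<And>x. x \<in> M \<Longrightarrow> x \<noteq> 0 \<Longrightarrow> hypercyclic T x"
    by (auto simp: hypercyclic_subspace_def)
  obtain p' where p': "continuous_seminorm scaleX p'" "\<And>x. hypercyclic T x \<Longrightarrow> p' x > 0"
    using assms(9) by blast
  obtain E :: "nat \<Rightarrow> 'a set" and C :: "nat \<Rightarrow> real" and q
    where E: "\<And>n. n \<ge> 1 \<Longrightarrow> X.subspace (E n)" "\<And>n. n \<ge> 1 \<Longrightarrow> finite_codim scaleX (E n)"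
      and C: "filterlim C at_top sequentially"
      and q: "continuous_seminorm scaleY q"
      and le: "\<And>n x. n \<ge> 1 \<Longrightarrow> x \<in> E n \<Longrightarrow> C n * p n x \<le> q (T n x)"
    using assms(10) by blast
  have T_add: "T n (x + y) = T n x + T n y" and T_scale: "T n (scaleX c x) = scaleY c (T n x)"
    and T_cont: "continuous_on UNIV (T n)" if "n \<ge> 1" for n x y c
    using assms(5)[OF that] unfolding continuous_linear_def Vector_Spaces.linear_iff by auto
  have r: "continuous_seminorm scaleX (\<lambda>x. q (T n x))" if "n \<ge> 1" for n
    using q T_cont[OF that] unfolding continuous_seminorm_def seminorm_def
    by (auto simp: T_add[OF that] T_scale[OF that] intro: continuous_on_compose2)
  obtain x N where x: "x \<in> M" "\<And>n. n \<ge> N \<Longrightarrow> q (T n x) \<ge> 1"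
  proof (rule X.ex_vector_eventually_large[where p = p and E = E and C = C and M = M and p' = p'
        and r = "\<lambda>n x. q (T n x)"])
    show "p' x > 0" if "x \<in> M" "x \<noteq> 0" for x using p'(2) hyp that by blast
    show "cofinite_subspace scaleX (E n)" if "n \<ge> 1" for n
      using X.finite_codim_imp_cofinite E that by blast
  qed (use assms(6-8) M p'(1) r C le that in auto)
  have "x \<noteq> 0"
  proof
    assume "x = 0"
    \<comment> \<open>The maximum with \<open>1\<close> is taken because \<open>T n\<close> is
      linear only for \<open>n \<ge> 1\<close>; then \<open>q (T n 0) = 0\<close> contradicts the
      lower bound.\<close>
    define n where "n = max N 1"
    have "T n 0 = 0" using T_add[of n 0 0] by (simp add: n_def)
    moreover have "q (scaleY 0 0) = norm (0::'k) * q 0"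
      using q unfolding continuous_seminorm_def seminorm_def by blast
    ultimately show False using x(2)[of n] \<open>x = 0\<close> by (simp add: n_def)
  qed
  then show False using not_hypercyclic_if_eventually_ge_one[OF q, of N T x] x hyp by blast
qed

end
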